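(* Let $\mathbb{K}$ be a non-Archimedean valued field which is spherically complete, and let $X$ be the extended Bruhat-Tits building of $\mathrm{GL}(n,\mathbb{K})$, i.e. the set of all ultrametric norms on $\mathbb{K}^n$. Endow $X$ with the Goldman-Iwahori metric $$d(\eta,\eta')=\sup_{v\in \mathbb{K}^n\setminus\{0\}}\left|\log\frac{\eta(v)}{\eta'(v)}\right|,$$ i.e. the length metric associated to the standard piecewise $\ell^\infty$ metric on each apartment. Then the metric space $(X,d)$ is injective.
   Context: $\mathbb{K}$ has a non-Archimedean absolute value $|\cdot|:\mathbb{K}\to\mathbb{R}_+$; it is spherically complete if any decreasing family of balls in $\mathbb{K}$ has non-empty intersection (this includes local fields). An ultrametric norm on $V=\mathbb{K}^n$ is a map $\eta:V\to\mathbb{R}_+$ with $\eta(v)=0\iff v=0$, $\eta(\alpha v)=|\alpha|\eta(v)$, and $\eta(u+v)\leq\max(\eta(u),\eta(v))$. The apartment of $X$ associated to a basis $v_1,\dots,v_n$ of $V$ is $\{\eta_m\mid m\in\mathbb{R}^n\}\simeq\mathbb{R}^n$, where $\eta_m(\sum_i x_iv_i)=\max_{i}e^{m_i}|x_i|$; it carries the $\ell^\infty$ metric of $\mathbb{R}^n$. A metric space $(X,d)$ is injective if for any family $(x_i)_{i\in I}$ of points and any nonnegative reals $(r_i)_{i\in I}$ with $r_i+r_j\geq d(x_i,x_j)$ for all $i,j\in I$, the closed balls $B(x_i,r_i)$ have a non-empty common intersection. *)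

theory Defs
  imports "HOL-Analysis.Analysis"
begin

definition nonarch_abs :: "('a::field \<Rightarrow> real) \<Rightarrow> bool" where
  "nonarch_abs abv \<longleftrightarrow>
     (\<forall>x. 0 \<le> abv x) \<and>
     (\<forall>x. abv x = 0 \<longleftrightarrow> x = 0) \<and>
     (\<forall>x y. abv (x * y) = abv x * abv y) \<and>
     (\<forall>x y. abv (x + y) \<le> max (abv x) (abv y))"

(* Decreasing families are rendered as arbitrary chains of closed balls under inclusion. *)
definition spherically_complete :: "('a::field \<Rightarrow> real) \<Rightarrow> bool" where
  "spherically_complete abv \<longleftrightarrow>
     (\<forall>C. subset.chain {{y. abv (y - x) \<le> r} | x r. 0 < r} C \<longrightarrow> \<Inter>C \<noteq> {})"

definition ultrametric_norms :: "('a::field \<Rightarrow> real) \<Rightarrow> ('a^'n \<Rightarrow> real) set" where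
  "ultrametric_norms abv =
     {\<eta>. (\<forall>v. 0 \<le> \<eta> v) \<and>
          (\<forall>v. \<eta> v = 0 \<longleftrightarrow> v = 0) \<and>
          (\<forall>\<alpha> v. \<eta> (\<alpha> *s v) = abv \<alpha> * \<eta> v) \<and>
          (\<forall>u v. \<eta> (u + v) \<le> max (\<eta> u) (\<eta> v))}"

(* The value 0 off the set of norms is only a totalization: the locale Metric_space demands
   symmetry and nonnegativity on the whole type. *)
definition GI_dist :: "('a::field \<Rightarrow> real) \<Rightarrow> ('a^'n \<Rightarrow> real) \<Rightarrow> ('a^'n \<Rightarrow> real) \<Rightarrow> real" where
  "GI_dist abv \<eta> \<eta>' =
     (if \<eta> \<in> ultrametric_norms abv \<and> \<eta>' \<in> ultrametric_norms abv
      then (SUP v\<in>UNIV - {0}. \<bar>ln (\<eta> v / \<eta>' v)\<bar>) else 0)"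

definition is_basis :: "('n::finite \<Rightarrow> 'a::field^'n) \<Rightarrow> bool" where
  "is_basis b \<longleftrightarrow> inj b \<and> vec.independent (range b) \<and> vec.span (range b) = UNIV"

definition apartment_norm ::
  "('a::field \<Rightarrow> real) \<Rightarrow> ('n::finite \<Rightarrow> 'a^'n) \<Rightarrow> real^'n \<Rightarrow> 'a^'n \<Rightarrow> real" where
  "apartment_norm abv b m v =
     Max (range (\<lambda>i. exp (m $ i) * abv (vec.representation (range b) v (b i))))"

(* A path that is a concatenation of straight segments, each inside one apartment, together with
   its length. A segment has the l-infinity length infnorm (m - m') of its apartment. *)
inductive apartment_path ::
  "('a::field \<Rightarrow> real) \<Rightarrow> ('a^'n::finite \<Rightarrow> real) \<Rightarrow> ('a^'n \<Rightarrow> real) \<Rightarrow> real \<Rightarrow> bool"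
  for abv \<eta> where
  refl: "\<eta> \<in> ultrametric_norms abv \<Longrightarrow> apartment_path abv \<eta> \<eta> 0"
| step: "apartment_path abv \<eta> (apartment_norm abv b m) l \<Longrightarrow> is_basis b \<Longrightarrow>
         apartment_path abv \<eta> (apartment_norm abv b m') (l + infnorm (m - m'))"

(* Valued in ereal, so that it is infinite when no path joins the two points. *)
definition apartment_length_dist ::
  "('a::field \<Rightarrow> real) \<Rightarrow> ('a^'n::finite \<Rightarrow> real) \<Rightarrow> ('a^'n \<Rightarrow> real) \<Rightarrow> ereal" where
  "apartment_length_dist abv \<eta> \<eta>' = (INF l\<in>{l. apartment_path abv \<eta> \<eta>' l}. ereal l)"

(* A family (x i, r i) enters only through its set of pairs, so quantifying over sets F of pairs
   covers all index types; see injective_metric_family. *)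
definition injective_metric :: "'x set \<Rightarrow> ('x \<Rightarrow> 'x \<Rightarrow> real) \<Rightarrow> bool" where
  "injective_metric M d \<longleftrightarrow> Metric_space M d \<and>
     (\<forall>F \<subseteq> M \<times> {0..}. (\<forall>(x, r)\<in>F. \<forall>(y, s)\<in>F. d x y \<le> r + s) \<longrightarrow>
        (\<exists>z\<in>M. \<forall>(x, r)\<in>F. z \<in> Metric_space.mcball M d x r))"

lemma injective_metric_family:
  assumes "injective_metric M d"
    and "\<And>i. i \<in> I \<Longrightarrow> x i \<in> M" "\<And>i. i \<in> I \<Longrightarrow> 0 \<le> r i"
    and "\<And>i j. i \<in> I \<Longrightarrow> j \<in> I \<Longrightarrow> d (x i) (x j) \<le> r i + r j"
  shows "\<exists>z\<in>M. \<forall>i\<in>I. z \<in> Metric_space.mcball M d (x i) (r i)"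
proof -
  let ?F = "(\<lambda>i. (x i, r i)) ` I"
  have "?F \<subseteq> M \<times> {0..}" "\<forall>(y, s)\<in>?F. \<forall>(z, t)\<in>?F. d y z \<le> s + t"
    using assms(2-4) by auto
  then have "\<exists>z\<in>M. \<forall>(y, s)\<in>?F. z \<in> Metric_space.mcball M d y s"
    using assms(1) unfolding injective_metric_def by blast
  then show ?thesis by auto
qed

end

theory Submission
  imports Defs
begin

text \<open>Injectivity: given norms \<open>\<eta>\<^sub>i\<close> and radii with \<open>d \<eta>\<^sub>i \<eta>\<^sub>j \<le> r\<^sub>i + r\<^sub>j\<close>, the pointwise supremum
  of the norms \<open>exp (- r\<^sub>i) \<eta>\<^sub>i\<close> is again an ultrametric norm, and it lies between
  \<open>exp (- r\<^sub>j) \<eta>\<^sub>j\<close> and \<open>exp r\<^sub>j \<eta>\<^sub>j\<close> for every \<open>j\<close>.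

  Finiteness of \<open>d\<close> and equality with the length metric: over a spherically complete field any two
  norms \<open>\<alpha>\<close>, \<open>\<beta>\<close> lie in a common apartment. By the Hahn-Banach theorem every vector of every
  subspace has an orthogonal complement for a single norm, so \<open>\<beta>\<close> has an orthogonal basis, and \<open>\<alpha> / \<beta>\<close>
  attains its maximum at one of its members. A maximizing vector has a complement that is orthogonal
  for both norms, and one concludes by induction on the dimension.\<close>

section \<open>Non-Archimedean absolute values and ultrametric norms\<close>

locale nonarch_field =
  fixes abv :: "'a::field \<Rightarrow> real"
  assumes nonarch: "nonarch_abs abv"
begin

lemma abv_nonneg [simp]: "0 \<le> abv x"
  and abv_eq_0_iff [simp]: "abv x = 0 \<longleftrightarrow> x = 0"
  and abv_mult: "abv (x * y) = abv x * abv y"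
  and abv_add: "abv (x + y) \<le> max (abv x) (abv y)"
  using nonarch by (auto simp: nonarch_abs_def)

lemma abv_le_0_iff [simp]: "abv x \<le> 0 \<longleftrightarrow> x = 0"
  by (simp add: order_class.order_eq_iff flip: abv_eq_0_iff)

lemma abv_1 [simp]: "abv 1 = 1"
  using abv_mult[of 1 1] by simp

lemma abv_minus_1: "abv (- 1) = 1"
proof -
  have "(abv (- 1))\<^sup>2 = 1"
    using abv_mult[of "- 1" "- 1"] by (simp add: power2_eq_square)
  then show ?thesis
    using abv_nonneg[of "- 1"] by (auto simp: power2_eq_1_iff)
qed

lemma abv_diff_triangle: "abv (x - z) \<le> max (abv (x - y)) (abv (y - z))"
  using abv_add[of "x - y" "y - z"] by simp

lemma norm_zero_iff:
  "\<eta> \<in> ultrametric_norms abv \<Longrightarrow> \<eta> v = 0 \<longleftrightarrow> v = 0"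
  by (simp add: ultrametric_norms_def)

lemma norm_nonneg:
  "\<eta> \<in> ultrametric_norms abv \<Longrightarrow> 0 \<le> \<eta> v"
  by (simp add: ultrametric_norms_def)

lemma norm_pos:
  "\<eta> \<in> ultrametric_norms abv \<Longrightarrow> v \<noteq> 0 \<Longrightarrow> 0 < \<eta> v"
  by (simp add: norm_zero_iff norm_nonneg less_le)

lemma norm_scale:
  "\<eta> \<in> ultrametric_norms abv \<Longrightarrow> \<eta> (a *s v) = abv a * \<eta> v"
  by (simp add: ultrametric_norms_def)

lemma norm_add:
  "\<eta> \<in> ultrametric_norms abv \<Longrightarrow> \<eta> (u + v) \<le> max (\<eta> u) (\<eta> v)"
  by (simp add: ultrametric_norms_def)

lemma norm_minus:
  assumes "\<eta> \<in> ultrametric_norms abv"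
  shows "\<eta> (- v) = \<eta> v"
  using norm_scale[OF assms, of "- 1" v] by (simp add: abv_minus_1)

lemma norm_diff:
  assumes "\<eta> \<in> ultrametric_norms abv"
  shows "\<eta> (u - v) \<le> max (\<eta> u) (\<eta> v)"
  using norm_add[OF assms, of u "- v"] by (simp add: norm_minus[OF assms])

lemma norm_sum_le:
  assumes "\<eta> \<in> ultrametric_norms abv" "0 \<le> M" "\<And>b. b \<in> B \<Longrightarrow> \<eta> (g b) \<le> M"
  shows "\<eta> (\<Sum>b\<in>B. g b) \<le> M"
  using assms(3)
proof (induction B rule: infinite_finite_induct)
  case (insert b B)
  then show ?case
    using norm_add[OF assms(1), of "g b" "\<Sum>b\<in>B. g b"] by (force intro: order_trans)
qed (use assms(1,2) norm_zero_iff[of \<eta> 0] in auto)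

text \<open>By \<open>meet\<close>, the centre of the smaller of two balls lies in the larger one,
  so the ultrametric inequality puts the whole smaller ball inside it. The balls therefore form a
  chain. Positive radii are required because \<open>spherically_complete\<close> speaks of such
  balls only.\<close>

lemma balls_Inter_nonempty:
  assumes "spherically_complete abv"
    and radii: "\<And>x r. (x, r) \<in> F \<Longrightarrow> 0 < r"
    and meet: "\<And>x r y s. (x, r) \<in> F \<Longrightarrow> (y, s) \<in> F \<Longrightarrow> abv (x - y) \<le> max r s"
  shows "\<exists>z. \<forall>(x, r)\<in>F. abv (z - x) \<le> r"
proof -
  define C where "C = (\<lambda>(x, r). {y. abv (y - x) \<le> r}) ` F"
  have nested: "{z. abv (z - x) \<le> r} \<subseteq> {z. abv (z - y) \<le> s}"
    if "(x, r) \<in> F" "(y, s) \<in> F" "r \<le> s" for x r y s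
  proof clarify
    fix z assume "abv (z - x) \<le> r"
    moreover have "abv (x - y) \<le> s"
      using meet[OF that(1,2)] that(3) by simp
    ultimately show "abv (z - y) \<le> s"
      using abv_diff_triangle[of z y x] that(3) by simp
  qed
  have "subset.chain {{y. abv (y - x) \<le> r} | x r. 0 < r} C"
  proof (rule subset.chainI)
    show "C \<subseteq> {{y. abv (y - x) \<le> r} | x r. 0 < r}"
      using radii unfolding C_def by auto
  next
    fix A B assume "A \<in> C" "B \<in> C"
    then obtain x r y s where *: "(x, r) \<in> F" "(y, s) \<in> F"
      and AB: "A = {z. abv (z - x) \<le> r}" "B = {z. abv (z - y) \<le> s}"
      unfolding C_def by auto
    then have "A \<subseteq> B \<or> B \<subseteq> A"
      using nested[OF *] nested[OF *(2,1)] linear[of r s] by blast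
    then show "(\<subset>)\<^sup>=\<^sup>= A B \<or> (\<subset>)\<^sup>=\<^sup>= B A"
      by auto
  qed
  then have "\<Inter>C \<noteq> {}"
    using assms(1) unfolding spherically_complete_def by blast
  then obtain z where "z \<in> \<Inter>C"
    by blast
  then show ?thesis
    unfolding C_def by (intro exI[of _ z]) auto
qed

section \<open>The Hahn-Banach theorem of Ingleton\<close>

definition linear_form :: "('a^'n \<Rightarrow> 'a) \<Rightarrow> bool" where
  "linear_form f \<longleftrightarrow> (\<forall>x y. f (x + y) = f x + f y) \<and> (\<forall>c x. f (c *s x) = c * f x)"

lemma linear_form_diff: "linear_form f \<Longrightarrow> f (x - y) = f x - f y"
  using diff_add_cancel[of x y] unfolding linear_form_def by (metis eq_diff_eq)

lemma linear_form_zero: "linear_form f \<Longrightarrow> f 0 = 0"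
  using linear_form_diff[of f 0 0] by simp

lemma subspace_kernel: "linear_form f \<Longrightarrow> vec.subspace {x. f x = 0}"
  by (auto simp: vec.subspace_def linear_form_def linear_form_zero)

text \<open>For \<open>u\<close> in \<open>B\<close> this is the coordinate form of
  \<open>u\<close>. Such forms start the Hahn-Banach extension and adjust the value at each new
  basis vector.\<close>

lemma linear_form_representation:
  assumes "vec.independent B" "vec.span B = UNIV"
  shows "linear_form (\<lambda>w. vec.representation B w u)"
  using assms by (simp add: linear_form_def vec.representation_add vec.representation_scale)

text \<open>The value at a new vector \<open>u\<close> has to lie in all the balls of centre \<open>f w\<close> and radius
  \<open>\<eta> (u - w) / \<eta> v\<close>; by the ultrametric inequality these balls are nested.\<close>
lemma extension_value:
  assumes sc: "spherically_complete abv" and \<eta>: "\<eta> \<in> ultrametric_norms abv"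
    and "v \<noteq> 0" and f: "linear_form f" and W: "vec.subspace W" and "u \<notin> W"
    and bound: "\<And>w. w \<in> W \<Longrightarrow> abv (f w) * \<eta> v \<le> \<eta> w"
  shows "\<exists>z. \<forall>w\<in>W. abv (z - f w) * \<eta> v \<le> \<eta> (u - w)"
proof -
  have v: "0 < \<eta> v"
    using norm_pos[OF \<eta> \<open>v \<noteq> 0\<close>] .
  define F where "F = (\<lambda>w. (f w, \<eta> (u - w) / \<eta> v)) ` W"
  have "\<exists>z. \<forall>(x, r)\<in>F. abv (z - x) \<le> r"
  proof (rule balls_Inter_nonempty[OF sc])
    fix x r assume "(x, r) \<in> F"
    then obtain w where w: "w \<in> W" "r = \<eta> (u - w) / \<eta> v"
      unfolding F_def by blast
    then have "u - w \<noteq> 0"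
      using \<open>u \<notin> W\<close> by auto
    then show "0 < r"
      using w v norm_pos[OF \<eta>] by simp
  next
    fix x r y s assume "(x, r) \<in> F" "(y, s) \<in> F"
    then obtain w w' where w: "w \<in> W" "w' \<in> W" "x = f w" "y = f w'"
      "r = \<eta> (u - w) / \<eta> v" "s = \<eta> (u - w') / \<eta> v"
      unfolding F_def by blast
    \<comment> \<open>Two centres differ by the value of \<open>f\<close> at
      \<open>w - w' = (u - w') - (u - w)\<close>, and both terms of that difference have norms given
      by the radii.\<close>
    have "abv (f w - f w') * \<eta> v \<le> \<eta> (w - w')"
      using bound[of "w - w'"] w W linear_form_diff[OF f] by (simp add: vec.subspace_diff)
    also have "\<dots> \<le> max (\<eta> (u - w)) (\<eta> (u - w'))"
      using norm_diff[OF \<eta>, of "u - w'" "u - w"] by (simp add: max.commute)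
    finally have "abv (f w - f w') \<le> max (\<eta> (u - w)) (\<eta> (u - w')) / \<eta> v"
      using v by (simp add: pos_le_divide_eq)
    also have "\<dots> = max r s"
      using w v by (simp add: max_divide_distrib_right)
    finally show "abv (x - y) \<le> max r s"
      using w by simp
  qed
  then show ?thesis
    using v unfolding F_def by (auto simp: pos_le_divide_eq)
qed

text \<open>The form \<open>c *s v\<close> \<mapsto> \<open>c\<close> on the line of
  \<open>v\<close> is extended one basis vector at a time, so an induction over a finite basis takes
  the place of Zorn's lemma. Each form is defined on the whole space; only the span on which the
  bound holds grows.\<close>

lemma norming_linear_form:
  fixes \<eta> :: "'a^'n::finite \<Rightarrow> real"
  assumes sc: "spherically_complete abv" and \<eta>: "\<eta> \<in> ultrametric_norms abv" and "v \<noteq> 0"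
  shows "\<exists>f. linear_form f \<and> f v = 1 \<and> (\<forall>w. abv (f w) * \<eta> v \<le> \<eta> w)"
proof -
  have "vec.independent {v}"
    using \<open>v \<noteq> 0\<close> by simp
  then obtain B where B: "v \<in> B" "vec.independent B" "vec.span B = UNIV"
    using vec.extend_basis_superset vec.independent_extend_basis vec.span_extend_basis by blast
  have "finite (B - {v})"
    using B vec.finiteI_independent by simp
  from this subset_refl have "\<exists>f. linear_form f \<and> f v = 1 \<and>
    (\<forall>w\<in>vec.span (insert v (B - {v})). abv (f w) * \<eta> v \<le> \<eta> w)"
  proof (induction rule: finite_subset_induct'[consumes 2, case_names empty insert])
    case empty
    let ?f = "\<lambda>w. vec.representation B w v"
    have f: "linear_form ?f" "?f v = 1"
      using linear_form_representation B by (auto simp: vec.representation_basis)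
    moreover have "abv (?f w) * \<eta> v \<le> \<eta> w" if "w \<in> vec.span {v}" for w
    proof -
      obtain k where "w = k *s v"
        using \<open>w \<in> vec.span {v}\<close> by (auto simp: vec.span_singleton)
      then show ?thesis
        using f by (simp add: linear_form_def norm_scale[OF \<eta>])
    qed
    ultimately show ?case
      by blast
  next
    case (insert u S)
    then obtain f where f: "linear_form f" "f v = 1"
      and bound: "\<And>w. w \<in> vec.span (insert v S) \<Longrightarrow> abv (f w) * \<eta> v \<le> \<eta> w"
      by blast
    define W where "W = vec.span (insert v S)"
    \<comment> \<open>\<open>g\<close> vanishes on \<open>W\<close> and is 1 at \<open>u\<close>, so
      adding a multiple of it changes the value at \<open>u\<close> and keeps \<open>f\<close> on
      \<open>W\<close>.\<close>
    define g where "g w = vec.representation B w u" for w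
    have g: "linear_form g" "g u = 1"
      using linear_form_representation[OF B(2,3), of u] B insert.hyps
      by (auto simp: vec.representation_basis g_def[abs_def])
    have "insert v S \<subseteq> {x. g x = 0}"
      using B(1) insert.hyps by (auto simp: g_def vec.representation_basis[OF B(2)] subset_eq)
    then have gW: "g w = 0" if "w \<in> W" for w
      using vec.span_minimal[OF _ subspace_kernel[OF g(1)]] that unfolding W_def by blast
    then have "u \<notin> W"
      using g by auto
    then obtain z where z: "\<And>w. w \<in> W \<Longrightarrow> abv (z - f w) * \<eta> v \<le> \<eta> (u - w)"
      using extension_value[OF sc \<eta> \<open>v \<noteq> 0\<close> f(1), of W u] bound
      unfolding W_def by auto
    \<comment> \<open>The coefficient is chosen to give \<open>h u = z\<close>.\<close>
    define h where "h w = f w + (z - f u) * g w" for w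
    have "linear_form h"
      using f g unfolding linear_form_def h_def by (simp add: algebra_simps)
    moreover have "h v = 1"
      using f gW[of v] by (simp add: h_def W_def vec.span_base)
    moreover have "abv (h x) * \<eta> v \<le> \<eta> x" if "x \<in> vec.span (insert v (insert u S))" for x
    proof -
      obtain k where k: "x - k *s u \<in> W"
        using \<open>x \<in> _\<close> unfolding W_def insert_commute[of v u] vec.span_breakdown_eq[of x u] by blast
      define w where "w = x - k *s u"
      have w: "w \<in> W" and x: "x = w + k *s u"
        using k by (auto simp: w_def)
      have hx: "h x = f w + k * z"
        using f(1) g gW[OF w] unfolding h_def x linear_form_def by (simp add: algebra_simps)
      show ?thesis
      proof (cases "k = 0")
        case True
        then show ?thesis
          using hx x w bound by (simp add: W_def)
      next
        case False
        \<comment> \<open>This makes \<open>x = k *s (u - w')\<close> and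
          \<open>h x = k * (z - f w')\<close>, so the bound for \<open>h\<close> at \<open>x\<close>
          is the ball condition on \<open>z\<close> at \<open>w'\<close>, multiplied by
          \<open>abv k\<close>.\<close>
        define w' where "w' = (- inverse k) *s w"
        have w': "w' \<in> W"
          using w unfolding w'_def W_def by (rule vec.span_scale)
        have "f w' = - inverse k * f w"
          using f(1) unfolding w'_def linear_form_def by blast
        then have "k * (z - f w') = h x"
          using False hx by (simp add: field_simps)
        moreover have "k *s (u - w') = x"
          using False unfolding w'_def x by (simp add: vector_ssub_ldistrib vector_smult_assoc)
        moreover have "abv k * (abv (z - f w') * \<eta> v) \<le> abv k * \<eta> (u - w')"
          using z[OF w'] by (rule mult_left_mono) simp
        ultimately show ?thesis
          by (metis abv_mult norm_scale[OF \<eta>] mult.assoc)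
      qed
    qed
    ultimately show ?case
      by blast
  qed
  moreover have "insert v (B - {v}) = B"
    using B by blast
  ultimately show ?thesis
    using B by simp
qed

section \<open>Simultaneous orthogonal bases\<close>

text \<open>For an ultrametric norm the reverse estimate is automatic, so this says that the norm of
  a combination is the maximum of the norms of its terms. The zero vector would satisfy the
  inequality and has to be excluded separately.\<close>

definition orthogonal_set :: "('a^'n \<Rightarrow> real) \<Rightarrow> ('a^'n) set \<Rightarrow> bool" where
  "orthogonal_set \<eta> B \<longleftrightarrow> finite B \<and> 0 \<notin> B \<and>
     (\<forall>c. \<forall>b\<in>B. abv (c b) * \<eta> b \<le> \<eta> (\<Sum>b\<in>B. c b *s b))"

lemma orthogonal_set_independent:
  fixes \<eta> :: "'a^'n::finite \<Rightarrow> real"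
  assumes \<eta>: "\<eta> \<in> ultrametric_norms abv" and B: "orthogonal_set \<eta> B"
  shows "vec.independent B"
proof (rule vec.independent_if_scalars_zero)
  show "finite B"
    using B by (simp add: orthogonal_set_def)
  fix c b assume *: "(\<Sum>b\<in>B. c b *s b) = 0" "b \<in> B"
  then have "abv (c b) * \<eta> b \<le> \<eta> 0"
    using B unfolding orthogonal_set_def by metis
  moreover have "0 < \<eta> b"
    using B * norm_pos[OF \<eta>, of b] by (auto simp: orthogonal_set_def)
  ultimately show "c b = 0"
    using norm_zero_iff[OF \<eta>, of 0] by (auto simp: mult_le_0_iff)
qed

text \<open>On a combination \<open>x\<close>, the form \<open>f\<close> reads off the coefficient
  of \<open>v\<close>, and \<open>bound\<close> controls that term by \<open>\<eta> x\<close>. The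
  remainder is then at most \<open>\<eta> x\<close> as well, and orthogonality of \<open>B\<close>
  controls its terms. The bound is asked only on the span, since for the second of two norms it is
  known only on a subspace.\<close>

lemma orthogonal_set_insert:
  fixes \<eta> :: "'a^'n::finite \<Rightarrow> real"
  assumes \<eta>: "\<eta> \<in> ultrametric_norms abv" and f: "linear_form f" "f v = 1"
    and B: "orthogonal_set \<eta> B" "B \<subseteq> {x. f x = 0}"
    and bound: "\<And>w. w \<in> vec.span (insert v B) \<Longrightarrow> abv (f w) * \<eta> v \<le> \<eta> w"
  shows "orthogonal_set \<eta> (insert v B)"
proof -
  have fin: "finite B" and "v \<notin> B" and "v \<noteq> 0"
    using B f linear_form_zero[of f] by (auto simp: orthogonal_set_def)
  have "abv (c b) * \<eta> b \<le> \<eta> (\<Sum>b\<in>insert v B. c b *s b)" if "b \<in> insert v B" for c b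
  proof -
    define y where "y = (\<Sum>b\<in>B. c b *s b)"
    define x where "x = c v *s v + y"
    have x: "(\<Sum>b\<in>insert v B. c b *s b) = x"
      using fin \<open>v \<notin> B\<close> by (simp add: x_def y_def)
    have y: "y \<in> vec.span B"
      unfolding y_def by (intro vec.span_sum vec.span_scale vec.span_base)
    then have "f y = 0"
      using vec.span_minimal[OF B(2) subspace_kernel[OF f(1)]] by blast
    then have "f x = c v"
      using f by (simp add: x_def linear_form_def)
    moreover have "x \<in> vec.span (insert v B)"
      using y vec.span_mono[of B "insert v B"] unfolding x_def
      by (intro vec.span_add vec.span_scale) (auto intro: vec.span_base)
    ultimately have v: "abv (c v) * \<eta> v \<le> \<eta> x"
      using bound by metis
    have "\<eta> y \<le> max (\<eta> x) (\<eta> (c v *s v))"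
      using norm_diff[OF \<eta>, of x "c v *s v"] by (simp add: x_def)
    then have "\<eta> y \<le> \<eta> x"
      using v by (simp add: norm_scale[OF \<eta>])
    moreover have "abv (c b) * \<eta> b \<le> \<eta> y" if "b \<in> B" for b
      using B(1) that unfolding orthogonal_set_def y_def by blast
    ultimately show ?thesis
      using v that unfolding x by (auto intro: order_trans)
  qed
  then show ?thesis
    using fin B(1) \<open>v \<noteq> 0\<close> by (auto simp: orthogonal_set_def)
qed

text \<open>If \<open>v\<close> maximizes \<open>\<alpha> / \<beta>\<close> on \<open>W\<close>, then a form that norms \<open>v\<close> for \<open>\<alpha>\<close> is on \<open>W\<close>
  bounded for \<open>\<beta>\<close> as well, so its kernel is a complement of \<open>v\<close> orthogonal for both norms.\<close>
lemma common_orthogonal_set: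
  fixes \<alpha> \<beta> :: "'a^'n::finite \<Rightarrow> real"
  assumes sc: "spherically_complete abv"
    and \<alpha>: "\<alpha> \<in> ultrametric_norms abv" and \<beta>: "\<beta> \<in> ultrametric_norms abv"
    and max: "\<And>W. vec.subspace W \<Longrightarrow> W \<noteq> {0} \<Longrightarrow>
      \<exists>v\<in>W. v \<noteq> 0 \<and> (\<forall>w\<in>W. \<alpha> w * \<beta> v \<le> \<alpha> v * \<beta> w)"
    and "vec.subspace W"
  shows "\<exists>B. orthogonal_set \<alpha> B \<and> orthogonal_set \<beta> B \<and> vec.span B = W"
  using assms(5)
proof (induction "vec.dim W" arbitrary: W rule: less_induct)
  case less
  show ?case
  proof (cases "W = {0}")
    case True
    then show ?thesis
      by (intro exI[of _ "{}"]) (simp add: orthogonal_set_def)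
  next
    case False
    then obtain v where v: "v \<in> W" "v \<noteq> 0"
      and vmax: "\<And>w. w \<in> W \<Longrightarrow> \<alpha> w * \<beta> v \<le> \<alpha> v * \<beta> w"
      using max less.prems by blast
    obtain f where f: "linear_form f" "f v = 1"
      and f\<alpha>: "\<And>w. abv (f w) * \<alpha> v \<le> \<alpha> w"
      using norming_linear_form[OF sc \<alpha> v(2)] by blast
    \<comment> \<open>In terms of quotients: \<open>abv (f w) \<le> \<alpha> w / \<alpha> v \<le>
      \<beta> w / \<beta> v\<close>, the second step by maximality at \<open>v\<close>.\<close>
    have f\<beta>: "abv (f w) * \<beta> v \<le> \<beta> w" if "w \<in> W" for w
    proof -
      have "(abv (f w) * \<alpha> v) * \<beta> v \<le> \<alpha> w * \<beta> v"
        by (intro mult_right_mono f\<alpha> norm_nonneg[OF \<beta>])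
      also have "\<dots> \<le> \<alpha> v * \<beta> w"
        using vmax that .
      finally have "\<alpha> v * (abv (f w) * \<beta> v) \<le> \<alpha> v * \<beta> w"
        by (simp add: mult_ac)
      then show ?thesis
        using norm_pos[OF \<alpha> v(2)] by simp
    qed
    define W' where "W' = W \<inter> {x. f x = 0}"
    have W': "vec.subspace W'"
      unfolding W'_def by (intro vec.subspace_inter less.prems subspace_kernel f)
    have "W' \<subset> W"
      using v f unfolding W'_def by force
    then have "vec.dim W' < vec.dim W"
      using W' less.prems by (intro vec.dim_psubset) (simp add: vec.span_eq_iff[THEN iffD2])
    then obtain B where B: "orthogonal_set \<alpha> B" "orthogonal_set \<beta> B" "vec.span B = W'"
      using less.hyps W' by blast
    have ker: "B \<subseteq> {x. f x = 0}" and BW: "B \<subseteq> W"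
      using B(3) vec.span_superset[of B] unfolding W'_def by blast+
    have span: "vec.span (insert v B) = W"
    proof
      show "vec.span (insert v B) \<subseteq> W"
        using v BW less.prems by (intro vec.span_minimal) auto
      show "W \<subseteq> vec.span (insert v B)"
      proof
        fix x assume "x \<in> W"
        then have "x - f x *s v \<in> W"
          using v less.prems by (intro vec.subspace_diff vec.subspace_scale)
        moreover have "f (x - f x *s v) = 0"
          using f linear_form_diff[OF f(1)] by (simp add: linear_form_def)
        ultimately show "x \<in> vec.span (insert v B)"
          unfolding vec.span_breakdown_eq B(3) W'_def by blast
      qed
    qed
    have "orthogonal_set \<alpha> (insert v B)"
      by (rule orthogonal_set_insert[OF \<alpha> f B(1) ker f\<alpha>])
    moreover have "orthogonal_set \<beta> (insert v B)"
      by (rule orthogonal_set_insert[OF \<beta> f B(2) ker]) (simp add: f\<beta> span)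
    ultimately show ?thesis
      using span by blast
  qed
qed

text \<open>\<open>common_orthogonal_set\<close> is used first with \<open>\<beta>\<close> in both
  places, where its maximality hypothesis is trivial. It yields a \<open>\<beta>\<close>-orthogonal
  basis of \<open>W\<close>, and the largest ratio over this finite basis bounds the ratio on all of
  \<open>W\<close>. This then supplies the maximality hypothesis for the pair
  \<open>\<alpha>\<close>, \<open>\<beta>\<close>.\<close>

lemma ratio_attains_max:
  fixes \<alpha> \<beta> :: "'a^'n::finite \<Rightarrow> real"
  assumes sc: "spherically_complete abv"
    and \<alpha>: "\<alpha> \<in> ultrametric_norms abv" and \<beta>: "\<beta> \<in> ultrametric_norms abv"
    and W: "vec.subspace W" "W \<noteq> {0}"
  shows "\<exists>v\<in>W. v \<noteq> 0 \<and> (\<forall>w\<in>W. \<alpha> w * \<beta> v \<le> \<alpha> v * \<beta> w)"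
proof -
  have triv: "\<exists>v\<in>U. v \<noteq> 0 \<and> (\<forall>w\<in>U. \<beta> w * \<beta> v \<le> \<beta> v * \<beta> w)"
    if "vec.subspace U" "U \<noteq> {0}" for U
  proof -
    have "\<exists>v\<in>U. v \<noteq> 0"
      using that vec.subspace_0[OF that(1)] by blast
    then show ?thesis
      by (auto simp: mult.commute)
  qed
  obtain B where B: "orthogonal_set \<beta> B" "vec.span B = W"
    using common_orthogonal_set[OF sc \<beta> \<beta> triv W(1)] by blast
  have fin: "finite B" and "B \<noteq> {}"
    using B W(2) by (auto simp: orthogonal_set_def)
  define R where "R b = \<alpha> b / \<beta> b" for b
  have "Max (R ` B) \<in> R ` B"
    using fin \<open>B \<noteq> {}\<close> by (intro Max_in) auto
  then obtain v where v: "v \<in> B" "R v = Max (R ` B)"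
    by force
  have Rv: "R b \<le> R v" if "b \<in> B" for b
    using that fin v(2) by simp
  have pos: "0 < \<beta> b" if "b \<in> B" for b
    using that B(1) norm_pos[OF \<beta>, of b] by (auto simp: orthogonal_set_def)
  have "0 \<le> R v"
    unfolding R_def by (intro divide_nonneg_nonneg norm_nonneg \<alpha> \<beta>)
  have "\<alpha> w * \<beta> v \<le> \<alpha> v * \<beta> w" if "w \<in> W" for w
  proof -
    obtain c where w: "w = (\<Sum>b\<in>B. c b *s b)"
      using \<open>w \<in> W\<close> vec.span_finite[OF fin] unfolding B(2) by blast
    \<comment> \<open>By the ultrametric inequality for \<open>\<alpha>\<close> it suffices to bound
      each term, and \<open>\<beta>\<close>-orthogonality bounds the \<open>\<beta>\<close>-norm of
      a term by \<open>\<beta> w\<close>.\<close>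
    have "\<alpha> w \<le> R v * \<beta> w"
      unfolding w
    proof (rule norm_sum_le[OF \<alpha>])
      show "0 \<le> R v * \<beta> (\<Sum>b\<in>B. c b *s b)"
        using \<open>0 \<le> R v\<close> norm_nonneg[OF \<beta>] by simp
      fix b assume b: "b \<in> B"
      have "\<alpha> (c b *s b) = R b * (abv (c b) * \<beta> b)"
        using pos[OF b] by (simp add: norm_scale[OF \<alpha>] R_def)
      also have "\<dots> \<le> R v * \<beta> (\<Sum>b\<in>B. c b *s b)"
        using Rv[OF b] \<open>0 \<le> R v\<close> B(1) b norm_nonneg[OF \<beta>, of b]
        by (intro mult_mono) (auto simp: orthogonal_set_def)
      finally show "\<alpha> (c b *s b) \<le> R v * \<beta> (\<Sum>b\<in>B. c b *s b)" .
    qed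
    then show ?thesis
      using pos[OF v(1)] by (simp add: R_def field_simps)
  qed
  moreover have "v \<in> W" "v \<noteq> 0"
    using v(1) B vec.span_base by (auto simp: orthogonal_set_def)
  ultimately show ?thesis
    by blast
qed

lemma simultaneous_orthogonal_basis:
  fixes \<alpha> \<beta> :: "'a^'n::finite \<Rightarrow> real"
  assumes sc: "spherically_complete abv"
    and \<alpha>: "\<alpha> \<in> ultrametric_norms abv" and \<beta>: "\<beta> \<in> ultrametric_norms abv"
  obtains b :: "'n \<Rightarrow> 'a^'n" where "is_basis b"
    "orthogonal_set \<alpha> (range b)" "orthogonal_set \<beta> (range b)"
proof -
  obtain B where B: "orthogonal_set \<alpha> B" "orthogonal_set \<beta> B" "vec.span B = UNIV"
    using common_orthogonal_set[OF sc \<alpha> \<beta> ratio_attains_max[OF sc \<alpha> \<beta>] vec.subspace_UNIV]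
    by blast
  have ind: "vec.independent B"
    by (rule orthogonal_set_independent[OF \<alpha> B(1)])
  \<comment> \<open>The dimension count allows \<open>B\<close> to be indexed by the coordinate
    type, as apartments require.\<close>
  have "card B = CARD('n)"
    using vec.dim_eq_card[of B UNIV] ind B(3) vec_dim_card[where 'a = 'a and 'n = 'n] by simp
  moreover have "finite B"
    using B(1) by (simp add: orthogonal_set_def)
  ultimately obtain b :: "'n \<Rightarrow> 'a^'n" where "bij_betw b UNIV B"
    using finite_same_card_bij[of "UNIV :: 'n set" B] by auto
  then have "inj b" "range b = B"
    by (auto simp: bij_betw_def)
  then show thesis
    using that[of b] ind B by (simp add: is_basis_def)
qed

section \<open>Apartments\<close>

lemma apartment_norm_le_iff:
  "apartment_norm abv b m v \<le> M \<longleftrightarrow>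
     (\<forall>i. exp (m $ i) * abv (vec.representation (range b) v (b i)) \<le> M)"
  unfolding apartment_norm_def by (subst Max_le_iff) auto

lemma apartment_norm_ge:
  "exp (m $ i) * abv (vec.representation (range b) v (b i)) \<le> apartment_norm abv b m v"
  unfolding apartment_norm_def by (rule Max_ge) auto

lemma apartment_norm_attained:
  "\<exists>i. apartment_norm abv b m v = exp (m $ i) * abv (vec.representation (range b) v (b i))"
proof -
  have "apartment_norm abv b m v \<in>
    range (\<lambda>i. exp (m $ i) * abv (vec.representation (range b) v (b i)))"
    unfolding apartment_norm_def by (rule Max_in) auto
  then show ?thesis
    by blast
qed

lemma apartment_norm_nonneg: "0 \<le> apartment_norm abv b m v"
  using apartment_norm_attained[of b m v] by auto

lemma basis_expansion:
  assumes "is_basis b"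
  shows "(\<Sum>i\<in>UNIV. vec.representation (range b) v (b i) *s b i) = v"
  using vec.sum_representation_eq[of "range b" v "range b"] assms
  by (simp add: is_basis_def sum.reindex)

lemma apartment_norm_in_norms:
  assumes b: "is_basis b"
  shows "apartment_norm abv b m \<in> ultrametric_norms abv"
proof -
  let ?N = "apartment_norm abv b m"
  let ?x = "\<lambda>v i. vec.representation (range b) v (b i)"
  have ind: "vec.independent (range b)" "\<And>v. v \<in> vec.span (range b)"
    using b by (auto simp: is_basis_def)
  have add: "?x (u + v) i = ?x u i + ?x v i" for u v i
    using ind by (simp add: vec.representation_add)
  have scale: "?x (a *s v) i = a * ?x v i" for a v i
    using ind by (simp add: vec.representation_scale)
  have "?N v = 0 \<longleftrightarrow> v = 0" for v
  proof
    assume "?N v = 0"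
    then have "?x v i = 0" for i
      using apartment_norm_ge[of m i b v] by (simp add: mult_le_0_iff)
    then show "v = 0"
      using basis_expansion[OF b, of v] by simp
  next
    assume "v = 0"
    then show "?N v = 0"
      using apartment_norm_attained[of b m v] by (auto simp: vec.representation_zero)
  qed
  moreover have "?N (a *s v) = abv a * ?N v" for a v
  proof (rule antisym)
    show "?N (a *s v) \<le> abv a * ?N v"
      unfolding apartment_norm_le_iff scale abv_mult mult.left_commute[of "exp _"]
      by (intro allI mult_left_mono apartment_norm_ge abv_nonneg)
    obtain i where "?N v = exp (m $ i) * abv (?x v i)"
      using apartment_norm_attained by blast
    then show "abv a * ?N v \<le> ?N (a *s v)"
      using apartment_norm_ge[of m i b "a *s v"] by (simp add: scale abv_mult mult_ac)
  qed
  moreover have "?N (u + v) \<le> max (?N u) (?N v)" for u v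
    unfolding apartment_norm_le_iff add
  proof
    fix i
    have "exp (m $ i) * abv (?x u i + ?x v i) \<le> exp (m $ i) * max (abv (?x u i)) (abv (?x v i))"
      using abv_add by simp
    also have "\<dots> = max (exp (m $ i) * abv (?x u i)) (exp (m $ i) * abv (?x v i))"
      by (simp add: max_mult_distrib_left)
    also have "\<dots> \<le> max (?N u) (?N v)"
      by (intro max.mono apartment_norm_ge)
    finally show "exp (m $ i) * abv (?x u i + ?x v i) \<le> max (?N u) (?N v)" .
  qed
  ultimately show ?thesis
    by (simp add: ultrametric_norms_def apartment_norm_nonneg)
qed

text \<open>Passing from \<open>m'\<close> to \<open>m\<close> multiplies each coordinate weight by
  at most the exponential of the sup distance. Used in both orders of \<open>m\<close> and
  \<open>m'\<close>, this bounds the Goldman-Iwahori distance by the length of a segment in an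
  apartment.\<close>

lemma apartment_norm_le_exp_infnorm:
  "apartment_norm abv b m v \<le> exp (infnorm (m - m')) * apartment_norm abv b m' v"
  unfolding apartment_norm_le_iff
proof
  fix i
  let ?x = "abv (vec.representation (range b) v (b i))"
  have "m $ i - m' $ i \<le> infnorm (m - m')"
    using component_le_infnorm_cart[of "m - m'" i] by simp
  then have "exp (m $ i - m' $ i) * (exp (m' $ i) * ?x) \<le>
      exp (infnorm (m - m')) * apartment_norm abv b m' v"
    by (intro mult_mono apartment_norm_ge) auto
  then show "exp (m $ i) * ?x \<le> exp (infnorm (m - m')) * apartment_norm abv b m' v"
    by (simp add: exp_diff)
qed

text \<open>The weights are the values of \<open>\<eta>\<close> on the basis. Orthogonality gives
  one inequality, the ultrametric inequality applied to the basis expansion gives the other.\<close>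

lemma apartment_norm_of_orthogonal_basis:
  assumes \<eta>: "\<eta> \<in> ultrametric_norms abv" and b: "is_basis b" "orthogonal_set \<eta> (range b)"
  shows "apartment_norm abv b (\<chi> i. ln (\<eta> (b i))) = \<eta>"
proof
  fix v
  let ?x = "vec.representation (range b) v"
  let ?N = "apartment_norm abv b (\<chi> i. ln (\<eta> (b i)))"
  have pos: "0 < \<eta> (b i)" for i
    using b(2) by (intro norm_pos[OF \<eta>]) (auto simp: orthogonal_set_def)
  have v: "(\<Sum>u\<in>range b. ?x u *s u) = v"
    using b(1) vec.sum_representation_eq[of "range b" v "range b"] by (simp add: is_basis_def)
  show "?N v = \<eta> v"
  proof (rule antisym)
    have "abv (?x (b i)) * \<eta> (b i) \<le> \<eta> v" for i
    proof -
      have "abv (?x (b i)) * \<eta> (b i) \<le> \<eta> (\<Sum>u\<in>range b. ?x u *s u)"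
        using b(2) unfolding orthogonal_set_def by blast
      then show ?thesis
        unfolding v .
    qed
    then show "?N v \<le> \<eta> v"
      unfolding apartment_norm_le_iff using pos by (simp add: mult_ac)
  next
    have "\<eta> (?x u *s u) \<le> ?N v" if "u \<in> range b" for u
    proof -
      obtain i where "u = b i"
        using \<open>u \<in> range b\<close> by blast
      then show ?thesis
        using apartment_norm_ge[of "\<chi> i. ln (\<eta> (b i))" i b v] pos[of i]
        by (simp add: norm_scale[OF \<eta>] mult_ac)
    qed
    then have "\<eta> (\<Sum>u\<in>range b. ?x u *s u) \<le> ?N v"
      by (rule norm_sum_le[OF \<eta> apartment_norm_nonneg])
    then show "\<eta> v \<le> ?N v"
      using v by simp
  qed
qed

text \<open>The explicit coordinates are recorded because their differences are the log ratios at
  the basis vectors, which is how a segment is later compared with the supremum.\<close>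

lemma common_apartment:
  fixes \<alpha> \<beta> :: "'a^'n::finite \<Rightarrow> real"
  assumes sc: "spherically_complete abv"
    and \<alpha>: "\<alpha> \<in> ultrametric_norms abv" and \<beta>: "\<beta> \<in> ultrametric_norms abv"
  obtains b m m' where "is_basis b" "\<alpha> = apartment_norm abv b m" "\<beta> = apartment_norm abv b m'"
    "\<And>i. m $ i = ln (\<alpha> (b i))" "\<And>i. m' $ i = ln (\<beta> (b i))"
proof -
  obtain b :: "'n \<Rightarrow> 'a^'n" where b: "is_basis b"
    "orthogonal_set \<alpha> (range b)" "orthogonal_set \<beta> (range b)"
    using simultaneous_orthogonal_basis[OF assms] .
  show thesis
    by (rule that[OF b(1) apartment_norm_of_orthogonal_basis[OF \<alpha> b(1,2), symmetric]
          apartment_norm_of_orthogonal_basis[OF \<beta> b(1,3), symmetric]]) auto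
qed

section \<open>The Goldman-Iwahori metric\<close>

text \<open>Turns distance bounds into multiplicative inequalities between norms, which remain
  meaningful at the zero vector.\<close>

lemma abs_ln_ratio_le_iff:
  fixes x y r :: real
  assumes "0 < x" "0 < y"
  shows "\<bar>ln (x / y)\<bar> \<le> r \<longleftrightarrow> x \<le> exp r * y \<and> y \<le> exp r * x"
proof -
  have "ln x - ln y \<le> r \<longleftrightarrow> x \<le> exp r * y"
    using assms ln_le_cancel_iff[of x "exp r * y"] by (simp add: ln_mult algebra_simps)
  moreover have "ln y - ln x \<le> r \<longleftrightarrow> y \<le> exp r * x"
    using assms ln_le_cancel_iff[of y "exp r * x"] by (simp add: ln_mult algebra_simps)
  ultimately show ?thesis
    using assms by (auto simp: ln_div abs_le_iff)
qed

text \<open>In a common apartment all log ratios are bounded by the sup distance of the coordinates.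
  Without this bound the real-valued supremum in \<open>GI_dist\<close> would carry no
  information.\<close>

lemma GI_dist_bdd_above:
  fixes \<alpha> \<beta> :: "'a^'n::finite \<Rightarrow> real"
  assumes sc: "spherically_complete abv"
    and \<alpha>: "\<alpha> \<in> ultrametric_norms abv" and \<beta>: "\<beta> \<in> ultrametric_norms abv"
  shows "bdd_above ((\<lambda>v. \<bar>ln (\<alpha> v / \<beta> v)\<bar>) ` (UNIV - {0}))"
proof -
  obtain b m m' where b: "\<alpha> = apartment_norm abv b m" "\<beta> = apartment_norm abv b m'"
    using common_apartment[OF assms] by blast
  have "\<bar>ln (\<alpha> v / \<beta> v)\<bar> \<le> infnorm (m - m')" if "v \<noteq> 0" for v
    using apartment_norm_le_exp_infnorm[of b m v m'] apartment_norm_le_exp_infnorm[of b m' v m]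
      norm_pos[OF \<alpha> that] norm_pos[OF \<beta> that] unfolding b
    by (subst abs_ln_ratio_le_iff) (auto simp: infnorm_sub)
  then show ?thesis
    by (intro bdd_aboveI2) auto
qed

lemma GI_dist_leI:
  fixes \<alpha> \<beta> :: "'a^'n::finite \<Rightarrow> real"
  assumes \<alpha>: "\<alpha> \<in> ultrametric_norms abv" and \<beta>: "\<beta> \<in> ultrametric_norms abv"
    and "\<And>v. \<alpha> v \<le> exp r * \<beta> v" "\<And>v. \<beta> v \<le> exp r * \<alpha> v"
  shows "GI_dist abv \<alpha> \<beta> \<le> r"
proof -
  \<comment> \<open>Index types are inhabited, so a nonzero vector exists and the supremum runs over
    a nonempty set.\<close>
  have "axis undefined 1 \<in> UNIV - {0 :: 'a^'n}"
    by (simp add: axis_eq_0_iff)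
  then have "(SUP v\<in>UNIV - {0}. \<bar>ln (\<alpha> v / \<beta> v)\<bar>) \<le> r"
    using assms norm_pos[OF \<alpha>] norm_pos[OF \<beta>]
    by (intro cSUP_least) (blast, simp add: abs_ln_ratio_le_iff)
  then show ?thesis
    using \<alpha> \<beta> by (simp add: GI_dist_def)
qed

lemma abs_ln_ratio_le_GI_dist:
  fixes \<alpha> \<beta> :: "'a^'n::finite \<Rightarrow> real"
  assumes sc: "spherically_complete abv"
    and \<alpha>: "\<alpha> \<in> ultrametric_norms abv" and \<beta>: "\<beta> \<in> ultrametric_norms abv" and "v \<noteq> 0"
  shows "\<bar>ln (\<alpha> v / \<beta> v)\<bar> \<le> GI_dist abv \<alpha> \<beta>"
  using cSUP_upper[OF _ GI_dist_bdd_above[OF sc \<alpha> \<beta>], of v] assms by (simp add: GI_dist_def)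

lemma le_exp_GI_dist:
  fixes \<alpha> \<beta> :: "'a^'n::finite \<Rightarrow> real"
  assumes sc: "spherically_complete abv"
    and \<alpha>: "\<alpha> \<in> ultrametric_norms abv" and \<beta>: "\<beta> \<in> ultrametric_norms abv"
    and "GI_dist abv \<alpha> \<beta> \<le> r"
  shows "\<alpha> v \<le> exp r * \<beta> v"
proof (cases "v = 0")
  case True
  then show ?thesis
    using norm_zero_iff[OF \<alpha>, of 0] norm_zero_iff[OF \<beta>, of 0] by simp
next
  case False
  then show ?thesis
    using abs_ln_ratio_le_GI_dist[OF sc \<alpha> \<beta> False] assms(4)
      abs_ln_ratio_le_iff[OF norm_pos[OF \<alpha> False] norm_pos[OF \<beta> False], of r] by simp
qed

lemma GI_dist_commute: "GI_dist abv \<alpha> \<beta> = GI_dist abv \<beta> \<alpha>"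
proof (cases "\<alpha> \<in> ultrametric_norms abv \<and> \<beta> \<in> ultrametric_norms abv")
  case True
  then have "\<bar>ln (\<alpha> v / \<beta> v)\<bar> = \<bar>ln (\<beta> v / \<alpha> v)\<bar>" if "v \<noteq> 0" for v
    using that norm_pos[of \<alpha> v] norm_pos[of \<beta> v] by (simp add: ln_div)
  then have "(SUP v\<in>UNIV - {0}. \<bar>ln (\<alpha> v / \<beta> v)\<bar>) = (SUP v\<in>UNIV - {0}. \<bar>ln (\<beta> v / \<alpha> v)\<bar>)"
    by (intro SUP_cong) auto
  then show ?thesis
    by (simp add: GI_dist_def)
qed (auto simp: GI_dist_def)

lemma GI_dist_nonneg:
  fixes \<alpha> \<beta> :: "'a^'n::finite \<Rightarrow> real"
  assumes sc: "spherically_complete abv"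
  shows "0 \<le> GI_dist abv \<alpha> \<beta>"
proof (cases "\<alpha> \<in> ultrametric_norms abv \<and> \<beta> \<in> ultrametric_norms abv")
  case True
  have "axis undefined 1 \<noteq> (0 :: 'a^'n)"
    by (simp add: axis_eq_0_iff)
  then show ?thesis
    using abs_ln_ratio_le_GI_dist[OF sc] True by (meson abs_ge_zero order_trans)
qed (auto simp: GI_dist_def)

lemma GI_dist_triangle:
  fixes \<alpha> \<beta> \<gamma> :: "'a^'n::finite \<Rightarrow> real"
  assumes sc: "spherically_complete abv" and \<alpha>: "\<alpha> \<in> ultrametric_norms abv"
    and \<beta>: "\<beta> \<in> ultrametric_norms abv" and \<gamma>: "\<gamma> \<in> ultrametric_norms abv"
  shows "GI_dist abv \<alpha> \<gamma> \<le> GI_dist abv \<alpha> \<beta> + GI_dist abv \<beta> \<gamma>"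
proof -
  \<comment> \<open>The outer norms are generalized so that the estimate can also be used with
    \<open>\<alpha>\<close> and \<open>\<gamma>\<close> exchanged.\<close>
  have trans: "\<alpha> v \<le> exp (GI_dist abv \<alpha> \<beta> + GI_dist abv \<beta> \<gamma>) * \<gamma> v"
    if "\<alpha> \<in> ultrametric_norms abv" "\<gamma> \<in> ultrametric_norms abv" for \<alpha> \<gamma> :: "'a^'n \<Rightarrow> real" and v
  proof -
    have "\<alpha> v \<le> exp (GI_dist abv \<alpha> \<beta>) * \<beta> v"
      using le_exp_GI_dist[OF sc that(1) \<beta>] by simp
    also have "\<dots> \<le> exp (GI_dist abv \<alpha> \<beta>) * (exp (GI_dist abv \<beta> \<gamma>) * \<gamma> v)"
      using le_exp_GI_dist[OF sc \<beta> that(2)] by simp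
    finally show ?thesis
      by (simp add: exp_add mult.assoc)
  qed
  show ?thesis
    using trans[OF \<alpha> \<gamma>] trans[OF \<gamma> \<alpha>]
    by (intro GI_dist_leI \<alpha> \<gamma>) (simp_all add: GI_dist_commute add.commute)
qed

lemma GI_dist_zero_iff:
  fixes \<alpha> \<beta> :: "'a^'n::finite \<Rightarrow> real"
  assumes sc: "spherically_complete abv"
    and \<alpha>: "\<alpha> \<in> ultrametric_norms abv" and \<beta>: "\<beta> \<in> ultrametric_norms abv"
  shows "GI_dist abv \<alpha> \<beta> = 0 \<longleftrightarrow> \<alpha> = \<beta>"
proof
  assume "GI_dist abv \<alpha> \<beta> = 0"
  then have "\<alpha> v \<le> \<beta> v" "\<beta> v \<le> \<alpha> v" for v
    using le_exp_GI_dist[OF sc \<alpha> \<beta>, of 0] le_exp_GI_dist[OF sc \<beta> \<alpha>, of 0]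
    by (simp_all add: GI_dist_commute)
  then show "\<alpha> = \<beta>"
    by (auto intro: antisym)
next
  assume "\<alpha> = \<beta>"
  then have "GI_dist abv \<alpha> \<beta> \<le> 0"
    using \<alpha> by (intro GI_dist_leI) auto
  then show "GI_dist abv \<alpha> \<beta> = 0"
    using GI_dist_nonneg[OF sc, of \<alpha> \<beta>] by simp
qed

lemma GI_Metric_space:
  assumes "spherically_complete abv"
  shows "Metric_space (ultrametric_norms abv :: ('a^'n::finite \<Rightarrow> real) set) (GI_dist abv)"
  by unfold_locales
    (use GI_dist_nonneg GI_dist_commute GI_dist_zero_iff GI_dist_triangle assms in blast)+

section \<open>Comparison with the length metric of the apartments\<close>

lemma apartment_path_GI_dist_le:
  fixes \<eta> \<eta>' :: "'a^'n::finite \<Rightarrow> real"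
  assumes sc: "spherically_complete abv" and \<eta>: "\<eta> \<in> ultrametric_norms abv"
    and "apartment_path abv \<eta> \<eta>' l"
  shows "GI_dist abv \<eta> \<eta>' \<le> l"
  using assms(3)
proof induction
  case refl
  then show ?case
    using GI_dist_zero_iff[OF sc \<eta> \<eta>] by simp
next
  case (step b m l m')
  note N = apartment_norm_in_norms[OF step.hyps(2)]
  have "GI_dist abv (apartment_norm abv b m) (apartment_norm abv b m') \<le> infnorm (m - m')"
    using apartment_norm_le_exp_infnorm[of b m _ m'] apartment_norm_le_exp_infnorm[of b m' _ m]
    by (intro GI_dist_leI N) (simp_all add: infnorm_sub)
  then show ?case
    using GI_dist_triangle[OF sc \<eta> N[of m] N[of m']] step.IH by linarith
qed

text \<open>No path is shorter than the distance, by \<open>apartment_path_GI_dist_le\<close>.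
  Conversely, a single segment in a common apartment is short enough: each coordinate difference is,
  in absolute value, the log ratio at a basis vector, hence one of the values under the
  supremum.\<close>

lemma GI_dist_eq_length:
  fixes \<alpha> \<beta> :: "'a^'n::finite \<Rightarrow> real"
  assumes sc: "spherically_complete abv"
    and \<alpha>: "\<alpha> \<in> ultrametric_norms abv" and \<beta>: "\<beta> \<in> ultrametric_norms abv"
  shows "ereal (GI_dist abv \<alpha> \<beta>) = apartment_length_dist abv \<alpha> \<beta>"
proof (rule antisym)
  show "ereal (GI_dist abv \<alpha> \<beta>) \<le> apartment_length_dist abv \<alpha> \<beta>"
    unfolding apartment_length_dist_def
    by (rule INF_greatest) (simp add: apartment_path_GI_dist_le[OF sc \<alpha>])
next
  obtain b m m' where b: "is_basis b"
    and N: "\<alpha> = apartment_norm abv b m" "\<beta> = apartment_norm abv b m'"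
    and m: "\<And>i. m $ i = ln (\<alpha> (b i))" "\<And>i. m' $ i = ln (\<beta> (b i))"
    using common_apartment[OF assms] by blast
  have path: "apartment_path abv \<alpha> \<beta> (0 + infnorm (m - m'))"
    using apartment_path.refl[OF \<alpha>] unfolding N by (rule apartment_path.step[OF _ b])
  have "\<bar>(m - m') $ i\<bar> \<le> GI_dist abv \<alpha> \<beta>" for i
  proof -
    have "b i \<noteq> 0"
      using b vec.dependent_zero[of "range b"] by (metis is_basis_def rangeI)
    then show ?thesis
      using abs_ln_ratio_le_GI_dist[OF sc \<alpha> \<beta>, of "b i"] norm_pos[OF \<alpha>, of "b i"]
        norm_pos[OF \<beta>, of "b i"] by (simp add: m ln_div)
  qed
  then have "infnorm (m - m') \<le> GI_dist abv \<alpha> \<beta>"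
    unfolding infnorm_cart by (intro cSup_least) auto
  moreover have "apartment_length_dist abv \<alpha> \<beta> \<le> ereal (infnorm (m - m'))"
    unfolding apartment_length_dist_def using path by (intro INF_lower) simp
  ultimately show "apartment_length_dist abv \<alpha> \<beta> \<le> ereal (GI_dist abv \<alpha> \<beta>)"
    by (meson ereal_less_eq(3) order_trans)
qed

section \<open>Injectivity\<close>

text \<open>Provides the common point for an empty family of balls.\<close>

lemma ultrametric_norms_nonempty:
  "(ultrametric_norms abv :: ('a^'n::finite \<Rightarrow> real) set) \<noteq> {}"
proof -
  have "vec.independent (cart_basis :: ('a^'n) set)" "vec.span (cart_basis :: ('a^'n) set) = UNIV"
    by (simp_all add: independent_cart_basis span_cart_basis)
  moreover obtain b :: "'n \<Rightarrow> 'a^'n" where "bij_betw b UNIV cart_basis"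
    using finite_same_card_bij[OF finite_class.finite_UNIV finite_cart_basis]
    by (metis card_cart_basis)
  ultimately have "is_basis b"
    by (auto simp: is_basis_def bij_betw_def)
  then show ?thesis
    using apartment_norm_in_norms by blast
qed

text \<open>\<open>bdd\<close> makes the supremum finite, and a single member of \<open>F\<close>
  already makes it positive on nonzero vectors.\<close>

lemma scaled_norms_Sup:
  fixes F :: "(('a^'n::finite \<Rightarrow> real) \<times> real) set"
  assumes norms: "\<And>\<eta> r. (\<eta>, r) \<in> F \<Longrightarrow> \<eta> \<in> ultrametric_norms abv"
    and "F \<noteq> {}"
    and bdd: "\<And>v. bdd_above ((\<lambda>(\<eta>, r). exp (- r) * \<eta> v) ` F)"
  shows "(\<lambda>v. SUP (\<eta>, r)\<in>F. exp (- r) * \<eta> v) \<in> ultrametric_norms abv"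
proof -
  let ?N = "\<lambda>v. SUP (\<eta>, r)\<in>F. exp (- r) * \<eta> v"
  have upper: "exp (- r) * \<eta> v \<le> ?N v" if "(\<eta>, r) \<in> F" for \<eta> r v
    using cSUP_upper[OF that bdd[of v]] by simp
  have least: "?N v \<le> M" if "\<And>\<eta> r. (\<eta>, r) \<in> F \<Longrightarrow> exp (- r) * \<eta> v \<le> M" for v M
    using \<open>F \<noteq> {}\<close> that by (intro cSUP_least) auto
  obtain \<eta>0 r0 where F0: "(\<eta>0, r0) \<in> F"
    using \<open>F \<noteq> {}\<close> by auto
  have nonneg: "0 \<le> ?N v" for v
    using upper[OF F0, of v] norm_nonneg[OF norms[OF F0], of v]
    by (meson exp_ge_zero mult_nonneg_nonneg order_trans)
  have zero: "?N v = 0 \<longleftrightarrow> v = 0" for v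
  proof
    assume "?N v = 0"
    then show "v = 0"
      using upper[OF F0, of v] norm_pos[OF norms[OF F0], of v]
      by (metis exp_gt_zero mult_pos_pos not_le)
  next
    assume "v = 0"
    then have "exp (- r) * \<eta> v \<le> 0" if "(\<eta>, r) \<in> F" for \<eta> r
      using \<open>v = 0\<close> norm_zero_iff[OF norms[OF that], of v] by simp
    then have "?N v \<le> 0"
      by (rule least)
    then show "?N v = 0"
      using nonneg[of v] by simp
  qed
  have scale_le: "?N (a *s v) \<le> abv a * ?N v" for a v
  proof (rule least)
    fix \<eta> r assume *: "(\<eta>, r) \<in> F"
    show "exp (- r) * \<eta> (a *s v) \<le> abv a * ?N v"
      using mult_left_mono[OF upper[OF *] abv_nonneg[of a]]
      by (simp add: norm_scale[OF norms[OF *]] mult_ac)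
  qed
  have scale: "?N (a *s v) = abv a * ?N v" for a v
  proof (cases "a = 0")
    case True
    then show ?thesis
      using zero[of 0] by simp
  next
    case False
    have inv: "abv a * abv (inverse a) = 1"
      using False abv_mult[of a "inverse a"] by simp
    \<comment> \<open>The reverse inequality comes from \<open>scale_le\<close> for the inverse
      scalar at \<open>a *s v\<close>.\<close>
    have "?N v \<le> abv (inverse a) * ?N (a *s v)"
      using scale_le[of "inverse a" "a *s v"] False by (simp add: vector_smult_assoc)
    then have "abv a * ?N v \<le> abv a * (abv (inverse a) * ?N (a *s v))"
      by (rule mult_left_mono) simp
    also have "\<dots> = ?N (a *s v)"
      using inv by (simp add: mult.assoc[symmetric])
    finally show ?thesis
      using scale_le[of a v] by (rule antisym[rotated])
  qed
  have "?N (u + v) \<le> max (?N u) (?N v)" for u v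
  proof (rule least)
    fix \<eta> r assume *: "(\<eta>, r) \<in> F"
    have "exp (- r) * \<eta> (u + v) \<le> max (exp (- r) * \<eta> u) (exp (- r) * \<eta> v)"
      using norm_add[OF norms[OF *], of u v] by (simp add: le_max_iff_disj)
    also have "\<dots> \<le> max (?N u) (?N v)"
      by (intro max.mono upper *)
    finally show "exp (- r) * \<eta> (u + v) \<le> max (?N u) (?N v)" .
  qed
  then show ?thesis
    using nonneg zero scale by (simp add: ultrametric_norms_def)
qed

lemma GI_injective:
  assumes sc: "spherically_complete abv"
  shows "injective_metric (ultrametric_norms abv :: ('a^'n::finite \<Rightarrow> real) set) (GI_dist abv)"
proof -
  let ?X = "ultrametric_norms abv :: ('a^'n \<Rightarrow> real) set"
  interpret Metric_space ?X "GI_dist abv"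
    by (rule GI_Metric_space[OF sc])
  have "\<exists>z\<in>?X. \<forall>(x, r)\<in>F. z \<in> mcball x r"
    if F: "F \<subseteq> ?X \<times> {0..}" and meet: "\<forall>(x, r)\<in>F. \<forall>(y, s)\<in>F. GI_dist abv x y \<le> r + s" for F
  proof (cases "F = {}")
    case True
    then show ?thesis
      using ultrametric_norms_nonempty by auto
  next
    case False
    \<comment> \<open>A norm within distance \<open>r\<close> of \<open>\<eta>\<close> is at least
      \<open>exp (- r) * \<eta>\<close> everywhere, so \<open>N\<close> is the smallest possible
      candidate.\<close>
    define N where "N v = (SUP (\<eta>, r)\<in>F. exp (- r) * \<eta> v)" for v :: "'a^'n"
    have norms: "\<eta> \<in> ?X" if "(\<eta>, r) \<in> F" for \<eta> r
      using F that by blast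
    \<comment> \<open>The pairwise hypothesis in multiplicative form: every lower constraint lies
      below every upper one. It gives both the finiteness of \<open>N\<close> and its upper
      bounds.\<close>
    have le: "exp (- r) * \<eta> v \<le> exp s * \<zeta> v" if "(\<eta>, r) \<in> F" "(\<zeta>, s) \<in> F" for \<eta> r \<zeta> s v
    proof -
      have "GI_dist abv \<eta> \<zeta> \<le> r + s"
        using meet that by blast
      then have "\<eta> v \<le> exp (r + s) * \<zeta> v"
        using le_exp_GI_dist[OF sc norms[OF that(1)] norms[OF that(2)]] by blast
      then have "exp (- r) * \<eta> v \<le> exp (- r) * (exp (r + s) * \<zeta> v)"
        by simp
      also have "\<dots> = exp s * \<zeta> v"
        by (simp add: mult.assoc[symmetric] flip: exp_add)
      finally show ?thesis .
    qed
    have bdd: "bdd_above ((\<lambda>(\<eta>, r). exp (- r) * \<eta> v) ` F)" for v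
    proof -
      obtain \<zeta> s where "(\<zeta>, s) \<in> F"
        using False by auto
      then show ?thesis
        using le by (intro bdd_aboveI2[where M = "exp s * \<zeta> v"]) auto
    qed
    have N: "N \<in> ?X"
      unfolding N_def[abs_def] by (rule scaled_norms_Sup[OF norms False bdd])
    have "N \<in> mcball \<eta> r" if "(\<eta>, r) \<in> F" for \<eta> r
    proof -
      have "N v \<le> exp r * \<eta> v" for v
        unfolding N_def using False le[OF _ that] by (intro cSUP_least) auto
      moreover have "\<eta> v \<le> exp r * N v" for v
      proof -
        have "exp (- r) * \<eta> v \<le> N v"
          using cSUP_upper[OF that bdd[of v]] by (simp add: N_def)
        then have "exp r * (exp (- r) * \<eta> v) \<le> exp r * N v"
          by simp
        then show ?thesis
          by (simp add: mult.assoc[symmetric] flip: exp_add)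
      qed
      ultimately have "GI_dist abv \<eta> N \<le> r"
        by (intro GI_dist_leI norms[OF that] N)
      then show ?thesis
        using N norms[OF that] by simp
    qed
    then show ?thesis
      using N by blast
  qed
  then show ?thesis
    unfolding injective_metric_def using Metric_space_axioms by blast
qed

end

theorem theorem2:
  fixes abv :: "'a::field \<Rightarrow> real"
    and X :: "('a^'n::finite \<Rightarrow> real) set"
  assumes "nonarch_abs abv"
    and "spherically_complete abv"
    and "X = ultrametric_norms abv"
  shows "(\<forall>\<eta>\<in>X. \<forall>\<eta>'\<in>X.
            bdd_above ((\<lambda>v. \<bar>ln (\<eta> v / \<eta>' v)\<bar>) ` (UNIV - {0})) \<and>
            ereal (GI_dist abv \<eta> \<eta>') = apartment_length_dist abv \<eta> \<eta>') \<and>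
         injective_metric X (GI_dist abv)"
proof -
  interpret nonarch_field abv
    by unfold_locales (rule assms(1))
  show ?thesis
    unfolding assms(3)
    by (intro conjI ballI GI_dist_bdd_above GI_dist_eq_length GI_injective assms(2))
qed

end
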